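(* In the logistic regression model with linear restrictions $H\beta=h$, for every $0<d<1$ the restricted almost unbiased Liu estimator $\hat\beta_{RAULE}$ is superior to the almost unbiased Liu estimator $\hat\beta_{AULE}$ in the MMSE sense, i.e. $$MMSE(\hat\beta_{AULE})-MMSE(\hat\beta_{RAULE})\ge 0.$$
   Context: Logistic regression model: $y_i=\pi_i+\varepsilon_i$, $i=1,\dots,n$, with $y_i$ Bernoulli of parameter $\pi_i=\exp(x_i'\beta)/(1+\exp(x_i'\beta))$, where $\beta\in\mathbb{R}^{p+1}$ is the unknown coefficient vector and $x_i'$ is the $i$th row of the $n\times(p+1)$ data matrix $X$. A prime denotes transpose. Let $C=X'\hat WX$, where $\hat W=\mathrm{Diag}(\hat\pi_i(1-\hat\pi_i))$. Convention (usual large-sample treatment): $C$ is a fixed symmetric positive definite $(p+1)\times(p+1)$ matrix, and the maximum likelihood estimator $\hat\beta_{MLE}$ is a random vector in $\mathbb{R}^{p+1}$ with $E(\hat\beta_{MLE})=\beta$ and $Cov(\hat\beta_{MLE})=C^{-1}$; no other property of the model is used. $H$ is a known $q\times(p+1)$ matrix of full row rank $q\le p+1$, $h\in\mathbb{R}^q$ is known, and the restrictions $H\beta=h$ are assumed to hold. Let $L_d=I-(1-d)^2(C+I)^{-2}$. The estimators are $$\hat\beta_{RMLE}=\hat\beta_{MLE}-C^{-1}H'(HC^{-1}H')^{-1}(H\hat\beta_{MLE}-h),\quad \hat\beta_{AULE}=L_d\hat\beta_{MLE},\quad \hat\beta_{RAULE}=L_d\hat\beta_{RMLE}.$$ For an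 estimator $\hat\theta$ of $\theta$, $MMSE(\hat\theta)=E[(\hat\theta-\theta)(\hat\theta-\theta)']$. For symmetric $M$, $M\ge 0$ means $M$ is nonnegative definite. *)

theory Defs
  imports "HOL-Probability.Probability"
begin

(* Dimensions are index types: CARD('n) is the number p + 1 of coefficients and CARD('q)
   the number q of restrictions. *)

definition positive_definite :: "real^'n^'n \<Rightarrow> bool" where
  "positive_definite A \<longleftrightarrow> transpose A = A \<and> (\<forall>v. v \<noteq> 0 \<longrightarrow> v \<bullet> (A *v v) > 0)"

definition nonneg_definite :: "real^'n^'n \<Rightarrow> bool" where
  "nonneg_definite A \<longleftrightarrow> transpose A = A \<and> (\<forall>v. v \<bullet> (A *v v) \<ge> 0)"

(* x y', with the column vector x and the row vector y' read as matrices with inner dimension 1. *)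
definition outer :: "real^'n \<Rightarrow> real^'n \<Rightarrow> real^'n^'n" where
  "outer x y = (columnvector x :: real^1^'n) ** (rowvector y :: real^'n^1)"

(* The integrals below are vector- and matrix-valued Bochner integrals. Integrability is not part
   of these definitions: a Bochner integral that does not exist is 0. *)

definition cov_matrix :: "'a measure \<Rightarrow> ('a \<Rightarrow> real^'n) \<Rightarrow> real^'n^'n" where
  "cov_matrix M X =
     (let \<mu> = (\<integral>\<omega>. X \<omega> \<partial>M) in \<integral>\<omega>. outer (X \<omega> - \<mu>) (X \<omega> - \<mu>) \<partial>M)"

definition MMSE :: "'a measure \<Rightarrow> ('a \<Rightarrow> real^'n) \<Rightarrow> real^'n \<Rightarrow> real^'n^'n" where
  "MMSE M T \<theta> = (\<integral>\<omega>. outer (T \<omega> - \<theta>) (T \<omega> - \<theta>) \<partial>M)"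

definition liu_matrix :: "real^'n^'n \<Rightarrow> real \<Rightarrow> real^'n^'n" where
  "liu_matrix C d =
     mat 1 - (1 - d)\<^sup>2 *\<^sub>R (matrix_inv (C + mat 1) ** matrix_inv (C + mat 1))"

(* The estimators as functions of the value b of the maximum likelihood estimator. *)

definition rmle :: "real^'n^'n \<Rightarrow> real^'n^'q \<Rightarrow> real^'q \<Rightarrow> real^'n \<Rightarrow> real^'n" where
  "rmle C H h b =
     b - (matrix_inv C ** transpose H ** matrix_inv (H ** matrix_inv C ** transpose H))
           *v (H *v b - h)"

definition aule :: "real^'n^'n \<Rightarrow> real \<Rightarrow> real^'n \<Rightarrow> real^'n" where
  "aule C d b = liu_matrix C d *v b"

definition raule :: "real^'n^'n \<Rightarrow> real^'n^'q \<Rightarrow> real^'q \<Rightarrow> real \<Rightarrow> real^'n \<Rightarrow> real^'n" where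
  "raule C H h d b = liu_matrix C d *v rmle C H h b"

end

theory Submission
  imports Defs
begin

text \<open>
  Both estimators are affine in the maximum likelihood estimator and have the same bias
  \<open>(L\<^sub>d - I)\<beta>\<close>, so the squared bias cancels in the difference of the two MMSE matrices. With
  \<open>S = C\<^sup>-\<^sup>1\<close>, \<open>K = (HSH')\<^sup>-\<^sup>1\<close> and \<open>P = I - SH'KH\<close> what remains is
  \<open>L\<^sub>d (S - PSP') L\<^sub>d' = L\<^sub>d SH'KHS L\<^sub>d'\<close>, which is nonnegative definite because \<open>K\<close> is.
\<close>

section \<open>Positive definite matrices\<close>

text \<open>Boundedness, and not just linearity, is what lets \<open>transpose\<close> be exchanged
  with a Bochner integral.\<close>

lemma bounded_linear_transpose: "bounded_linear (transpose :: real^'n^'m \<Rightarrow> _)"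
  by (intro linear_conv_bounded_linear[THEN iffD1] linearI)
    (simp_all add: vec_eq_iff transpose_def)

lemma transpose_diff:
  fixes A B :: "real^'n^'m"
  shows "transpose (A - B) = transpose A - transpose B"
  by (rule linear_diff[OF bounded_linear.linear[OF bounded_linear_transpose]])

lemma positive_definite_invertible:
  assumes "positive_definite A"
  shows "invertible A"
proof -
  have "x = 0" if "A *v x = 0" for x
    using assms that unfolding positive_definite_def by fastforce
  then show ?thesis
    using matrix_left_invertible_ker[of A] invertible_left_inverse by blast
qed

lemma matrix_inv_right:
  assumes "invertible A"
  shows "A ** matrix_inv A = mat 1"
  using someI_ex[OF assms[unfolded invertible_def]] by (simp add: matrix_inv_def)

lemma matrix_inv_mult_vec:
  fixes A :: "real^'n^'n"
  assumes "invertible A"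
  shows "A *v (matrix_inv A *v x) = x"
  using assms by (simp add: matrix_vector_mul_assoc matrix_inv_right)

lemma transpose_eq_inner_commute:
  fixes A :: "real^'n^'n"
  assumes "transpose A = A"
  shows "(A *v x) \<bullet> y = x \<bullet> (A *v y)"
  using dot_lmul_matrix[of x A y] assms by (metis transpose_matrix_vector)

lemma inner_mult_vec_transpose:
  fixes A :: "real^'n^'m"
  shows "x \<bullet> (A *v y) = (transpose A *v x) \<bullet> y"
  by (simp add: dot_lmul_matrix)

lemma positive_definite_matrix_inv:
  assumes "positive_definite A"
  shows "positive_definite (matrix_inv A)"
  unfolding positive_definite_def
proof (intro conjI allI impI)
  note inv = positive_definite_invertible[OF assms]
  have sym: "transpose A = A" using assms by (simp add: positive_definite_def)
  \<comment> \<open>Transposing \<open>A ** matrix_inv A = mat 1\<close> and using the symmetry of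
    \<open>A\<close> gives a left inverse, which must agree with the right inverse.\<close>
  have "transpose (matrix_inv A) ** A = mat 1"
    using matrix_inv_right[OF inv] sym by (metis matrix_transpose_mul transpose_mat)
  then show "transpose (matrix_inv A) = matrix_inv A"
    using matrix_inv_right[OF inv]
    by (metis matrix_mul_assoc matrix_mul_lid matrix_mul_rid)
  fix v :: "real^'a" assume "v \<noteq> 0"
  \<comment> \<open>Substituting \<open>v = A *v u\<close> turns the quadratic form of the inverse
    at \<open>v\<close> into that of \<open>A\<close> at \<open>u\<close>.\<close>
  define u where "u = matrix_inv A *v v"
  have v: "A *v u = v"
    unfolding u_def by (rule matrix_inv_mult_vec[OF inv])
  then have "u \<noteq> 0"
    using \<open>v \<noteq> 0\<close> by auto
  then have "0 < u \<bullet> (A *v u)"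
    using assms by (simp add: positive_definite_def)
  then show "0 < v \<bullet> (matrix_inv A *v v)"
    unfolding v u_def[symmetric] by (simp add: inner_commute)
qed

text \<open>Full row rank makes \<open>transpose H\<close> injective, and the form at
  \<open>v\<close> is that of \<open>S\<close> at \<open>transpose H *v v\<close>. This is what
  makes the matrix inverted in the restricted estimator invertible.\<close>

lemma positive_definite_congruence:
  fixes H :: "real^'n^'q"
  assumes "positive_definite S" and "rank H = CARD('q)"
  shows "positive_definite (H ** S ** transpose H)"
  unfolding positive_definite_def
proof (intro conjI allI impI)
  show "transpose (H ** S ** transpose H) = H ** S ** transpose H"
    using assms(1) by (simp add: positive_definite_def matrix_transpose_mul matrix_mul_assoc)
  fix v :: "real^'q" assume "v \<noteq> 0"
  have "inj ((*v) (transpose H))"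
    using assms(2) full_rank_injective[of "transpose H"] by (simp add: rank_transpose del: transpose_matrix_vector)
  then have "transpose H *v v \<noteq> 0"
    using \<open>v \<noteq> 0\<close> by (metis injD matrix_vector_mult_0_right)
  then have "0 < (transpose H *v v) \<bullet> (S *v (transpose H *v v))"
    using assms(1) by (simp add: positive_definite_def del: transpose_matrix_vector)
  then show "0 < v \<bullet> ((H ** S ** transpose H) *v v)"
    by (simp only: matrix_vector_mul_assoc[symmetric] inner_mult_vec_transpose)
qed

text \<open>Pythagoras for the inner product given by \<open>S\<close>: with \<open>K\<close>,
  \<open>u\<close>, \<open>g\<close> as defined in the proof, \<open>g\<close> is the projection of
  \<open>w\<close> onto the range of \<open>transpose H\<close>, and
  \<open>transpose P *v w = w - g\<close>. The two sides differ by the squared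
  \<open>S\<close>-length of \<open>g\<close>, which equals
  \<open>u \<bullet> (K *v u)\<close>.\<close>

lemma positive_definite_projection_le:
  fixes H :: "real^'n^'q" and S :: "real^'n^'n"
  defines "P \<equiv> mat 1 - S ** transpose H ** matrix_inv (H ** S ** transpose H) ** H"
  assumes "positive_definite S" and "rank H = CARD('q)"
  shows "(transpose P *v w) \<bullet> (S *v (transpose P *v w)) \<le> w \<bullet> (S *v w)"
proof -
  define K where "K = matrix_inv (H ** S ** transpose H)"
  note pd = positive_definite_congruence[OF assms(2,3)]
  have K: "positive_definite K"
    unfolding K_def by (rule positive_definite_matrix_inv[OF pd])
  define u where "u = H *v (S *v w)"
  define g where "g = transpose H *v (K *v u)"
  have S_sym: "transpose S = S" and K_sym: "transpose K = K"
    using assms(2) K by (simp_all add: positive_definite_def)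
  have "transpose P = mat 1 - transpose H ** K ** H ** S"
    unfolding P_def K_def[symmetric]
    by (simp add: transpose_diff matrix_transpose_mul transpose_mat S_sym K_sym matrix_mul_assoc)
  then have Pw: "transpose P *v w = w - g"
    unfolding g_def u_def
    by (simp only: matrix_vector_mult_diff_rdistrib matrix_vector_mul_lid matrix_vector_mul_assoc
        matrix_mul_assoc)
  have gw: "g \<bullet> (S *v w) = (K *v u) \<bullet> u"
    unfolding g_def u_def by (simp only: inner_mult_vec_transpose)
  \<comment> \<open>\<open>K\<close> cancels the factor \<open>H ** S ** transpose H\<close>, so
    \<open>g \<bullet> (S *v g)\<close> and \<open>g \<bullet> (S *v w)\<close> coincide; this is
    the orthogonality of \<open>g\<close> and \<open>w - g\<close>.\<close>
  have "H *v (S *v g) = u"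
    unfolding g_def using matrix_inv_mult_vec[OF positive_definite_invertible[OF pd], of u]
    by (simp only: K_def matrix_vector_mul_assoc matrix_mul_assoc)
  then have gg: "g \<bullet> (S *v g) = (K *v u) \<bullet> u"
    by (metis g_def inner_mult_vec_transpose)
  have wg: "w \<bullet> (S *v g) = g \<bullet> (S *v w)"
    using transpose_eq_inner_commute[OF S_sym] by (metis inner_commute)
  have "0 \<le> u \<bullet> (K *v u)"
    using K by (cases "u = 0") (auto simp: positive_definite_def less_imp_le)
  then show ?thesis
    unfolding Pw
    by (simp add: matrix_vector_mult_diff_distrib inner_diff_left inner_diff_right gw gg wg
        inner_commute)
qed

section \<open>Mean squared error matrices as quadratic forms\<close>

lemma outer_component: "outer x y $ i $ j = x $ i * y $ j"
  by (simp add: outer_def matrix_matrix_mult_def columnvector_def rowvector_def)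

lemma bounded_bilinear_outer: "bounded_bilinear outer"
  unfolding bilinear_conv_bounded_bilinear[symmetric] bilinear_def
  by (auto intro!: linearI simp: vec_eq_iff outer_component algebra_simps)

lemma transpose_outer: "transpose (outer x x) = outer x x"
  by (simp add: vec_eq_iff transpose_def outer_component mult.commute)

lemma inner_outer: "v \<bullet> (outer x x *v v) = (v \<bullet> x)\<^sup>2"
  by (simp add: inner_vec_def matrix_vector_mult_def outer_component power2_eq_square
      sum_product sum_distrib_left mult_ac)

text \<open>A bounded bilinear map is continuous, which gives measurability, and its norm on the
  diagonal is at most a constant times the squared norm, which is integrable.\<close>

lemma integrable_outer:
  fixes Z :: "'a \<Rightarrow> real^'n"
  assumes "Z \<in> borel_measurable M" and "integrable M (\<lambda>\<omega>. (norm (Z \<omega>))\<^sup>2)"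
  shows "integrable M (\<lambda>\<omega>. outer (Z \<omega>) (Z \<omega>))"
proof -
  obtain B where B: "\<And>x y :: real^'n. norm (outer x y) \<le> norm x * norm y * B"
    using bounded_bilinear.bounded[OF bounded_bilinear_outer] by blast
  show ?thesis
  proof (rule Bochner_Integration.integrable_bound)
    show "integrable M (\<lambda>\<omega>. (norm (Z \<omega>))\<^sup>2 * B)"
      using assms(2) by simp
    show "(\<lambda>\<omega>. outer (Z \<omega>) (Z \<omega>)) \<in> borel_measurable M"
      by (rule borel_measurable_continuous_Pair[OF assms(1) assms(1)])
        (intro bounded_bilinear.continuous_on[OF bounded_bilinear_outer] continuous_intros)
    show "AE \<omega> in M. norm (outer (Z \<omega>) (Z \<omega>)) \<le> norm ((norm (Z \<omega>))\<^sup>2 * B)"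
      using B by (auto simp: power2_eq_square intro!: AE_I2 order_trans[OF B])
  qed
qed

text \<open>For fixed \<open>v\<close> the form is linear in the matrix, so it passes through a
  matrix-valued integral and reduces matrix claims to scalar ones.\<close>

lemma bounded_linear_quadratic_form: "bounded_linear (\<lambda>A :: real^'n^'n. v \<bullet> (A *v v))"
  by (intro linear_conv_bounded_linear[THEN iffD1] linearI)
    (simp_all add: matrix_vector_mult_add_rdistrib inner_add_right scaleR_matrix_vector_assoc[symmetric])

lemma transpose_integral_outer:
  fixes Z :: "'a \<Rightarrow> real^'n"
  assumes "Z \<in> borel_measurable M" and "integrable M (\<lambda>\<omega>. (norm (Z \<omega>))\<^sup>2)"
  shows "transpose (\<integral>\<omega>. outer (Z \<omega>) (Z \<omega>) \<partial>M) = (\<integral>\<omega>. outer (Z \<omega>) (Z \<omega>) \<partial>M)"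
  using integral_bounded_linear[OF bounded_linear_transpose integrable_outer[OF assms]]
  by (simp add: transpose_outer)

lemma quadratic_form_integral_outer:
  fixes Z :: "'a \<Rightarrow> real^'n"
  assumes "Z \<in> borel_measurable M" and "integrable M (\<lambda>\<omega>. (norm (Z \<omega>))\<^sup>2)"
  shows "integrable M (\<lambda>\<omega>. (v \<bullet> Z \<omega>)\<^sup>2)"
    and "v \<bullet> ((\<integral>\<omega>. outer (Z \<omega>) (Z \<omega>) \<partial>M) *v v) = (\<integral>\<omega>. (v \<bullet> Z \<omega>)\<^sup>2 \<partial>M)"
  using integrable_bounded_linear[OF bounded_linear_quadratic_form integrable_outer[OF assms], of v]
    integral_bounded_linear[OF bounded_linear_quadratic_form integrable_outer[OF assms], of v]
  by (simp_all add: inner_outer)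

lemma (in prob_space) square_integrable_imp_integrable:
  fixes X :: "'a \<Rightarrow> 'b::euclidean_space"
  assumes "X \<in> borel_measurable M" and "integrable M (\<lambda>\<omega>. (norm (X \<omega>))\<^sup>2)"
  shows "integrable M X"
proof (rule Bochner_Integration.integrable_bound)
  show "integrable M (\<lambda>\<omega>. 1 + (norm (X \<omega>))\<^sup>2)"
    using assms(2) by simp
  \<comment> \<open>Expanding \<open>(norm x - 1)\<^sup>2 \<ge> 0\<close> bounds even
    \<open>2 * norm x\<close>; the constant 1 is integrable because the measure is finite.\<close>
  have "norm x \<le> 1 + (norm x)\<^sup>2" for x :: 'b
    using zero_le_power2[of "norm x - 1"] norm_ge_zero[of x]
    by (simp only: power2_diff power_one mult_1_right)
  then show "AE \<omega> in M. norm (X \<omega>) \<le> norm (1 + (norm (X \<omega>))\<^sup>2)"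
    by (intro AE_I2) (simp add: abs_of_nonneg)
qed (rule assms(1))

lemma (in prob_space) square_integrable_affine:
  fixes X :: "'a \<Rightarrow> real^'n" and G :: "real^'n^'m"
  assumes "X \<in> borel_measurable M" and "integrable M (\<lambda>\<omega>. (norm (X \<omega>))\<^sup>2)"
  shows "(\<lambda>\<omega>. G *v X \<omega> + c) \<in> borel_measurable M"
    and "integrable M (\<lambda>\<omega>. (norm (G *v X \<omega> + c))\<^sup>2)"
proof -
  show meas: "(\<lambda>\<omega>. G *v X \<omega> + c) \<in> borel_measurable M"
    using assms(1)
    by (intro borel_measurable_add borel_measurable_const
        borel_measurable_continuous_on[OF matrix_vector_mult_linear_continuous_on])
  obtain B where B: "0 < B" "\<And>x. norm (G *v x) \<le> norm x * B"
    using bounded_linear.pos_bounded[OF matrix_vector_mul_bounded_linear[of G]] by blast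
  \<comment> \<open>The elementary bound of the square of a sum by twice the sum of squares,
    combined with the operator bound \<open>B\<close> for \<open>G\<close>.\<close>
  have bound: "(norm (G *v x + c))\<^sup>2 \<le> 2 * (B\<^sup>2 * (norm x)\<^sup>2) + 2 * (norm c)\<^sup>2" for x
  proof -
    have "(norm (G *v x + c))\<^sup>2 \<le> (norm x * B + norm c)\<^sup>2"
      using norm_triangle_ineq[of "G *v x" c] B(2)[of x] by (intro power_mono) auto
    also have "\<dots> \<le> 2 * (B\<^sup>2 * (norm x)\<^sup>2) + 2 * (norm c)\<^sup>2"
      using zero_le_power2[of "norm x * B - norm c"]
      by (simp add: power2_diff power2_sum power_mult_distrib algebra_simps)
    finally show ?thesis .
  qed
  show "integrable M (\<lambda>\<omega>. (norm (G *v X \<omega> + c))\<^sup>2)"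
  proof (rule Bochner_Integration.integrable_bound)
    show "integrable M (\<lambda>\<omega>. 2 * (B\<^sup>2 * (norm (X \<omega>))\<^sup>2) + 2 * (norm c)\<^sup>2)"
      using assms(2) by simp
    show "(\<lambda>\<omega>. (norm (G *v X \<omega> + c))\<^sup>2) \<in> borel_measurable M"
      using meas by measurable
    show "AE \<omega> in M. norm ((norm (G *v X \<omega> + c))\<^sup>2)
        \<le> norm (2 * (B\<^sup>2 * (norm (X \<omega>))\<^sup>2) + 2 * (norm c)\<^sup>2)"
      using bound by (intro AE_I2) (simp add: abs_of_nonneg)
  qed
qed

text \<open>Bias-variance decomposition: the MMSE matrix is G Cov(X) G' + c c', where
  \<open>c\<close> is the bias. It is stated through symmetry and quadratic forms, the two
  ingredients of \<open>nonneg_definite\<close>.\<close>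

lemma (in prob_space) MMSE_affine:
  fixes X :: "'a \<Rightarrow> real^'n" and G :: "real^'n^'m" and \<theta> c :: "real^'m"
  defines "\<mu> \<equiv> \<integral>\<omega>. X \<omega> \<partial>M"
  assumes X: "X \<in> borel_measurable M" "integrable M (\<lambda>\<omega>. (norm (X \<omega>))\<^sup>2)"
    and T: "\<And>\<omega>. T \<omega> - \<theta> = G *v (X \<omega> - \<mu>) + c"
  shows "transpose (MMSE M T \<theta>) = MMSE M T \<theta>"
    and "v \<bullet> (MMSE M T \<theta> *v v) =
      (transpose G *v v) \<bullet> (cov_matrix M X *v (transpose G *v v)) + (v \<bullet> c)\<^sup>2"
proof -
  define Y where "Y = (\<lambda>\<omega>. X \<omega> - \<mu>)"
  define Z where "Z = (\<lambda>\<omega>. G *v Y \<omega> + c)"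
  have Y: "Y \<in> borel_measurable M" "integrable M (\<lambda>\<omega>. (norm (Y \<omega>))\<^sup>2)"
    using square_integrable_affine[OF X, of "mat 1" "- \<mu>"] by (simp_all add: Y_def)
  have Z: "Z \<in> borel_measurable M" "integrable M (\<lambda>\<omega>. (norm (Z \<omega>))\<^sup>2)"
    using square_integrable_affine[OF Y, of G c] by (simp_all add: Z_def)
  have MMSE: "MMSE M T \<theta> = (\<integral>\<omega>. outer (Z \<omega>) (Z \<omega>) \<partial>M)"
    by (simp add: MMSE_def T Z_def Y_def)
  show "transpose (MMSE M T \<theta>) = MMSE M T \<theta>"
    unfolding MMSE by (rule transpose_integral_outer[OF Z])
  define w where "w = transpose G *v v"
  have cov: "cov_matrix M X = (\<integral>\<omega>. outer (Y \<omega>) (Y \<omega>) \<partial>M)"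
    by (simp add: cov_matrix_def Let_def Y_def \<mu>_def)
  have intX: "integrable M X"
    by (rule square_integrable_imp_integrable[OF X])
  then have intY: "integrable M Y" and meanY: "(\<integral>\<omega>. Y \<omega> \<partial>M) = 0"
    by (simp_all add: Y_def \<mu>_def prob_space)
  note sq = quadratic_form_integral_outer[OF Y, of w]
  have "v \<bullet> (MMSE M T \<theta> *v v) = (\<integral>\<omega>. (v \<bullet> Z \<omega>)\<^sup>2 \<partial>M)"
    unfolding MMSE by (rule quadratic_form_integral_outer(2)[OF Z])
  also have "\<dots> = (\<integral>\<omega>. (w \<bullet> Y \<omega>)\<^sup>2 + 2 * (v \<bullet> c) * (w \<bullet> Y \<omega>) + (v \<bullet> c)\<^sup>2 \<partial>M)"
    by (simp only: Z_def w_def inner_add_right inner_mult_vec_transpose power2_sum)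
      (simp add: algebra_simps)
  \<comment> \<open>The cross term reduces to the mean of \<open>Y\<close>, which vanishes because
    \<open>Y\<close> is centred.\<close>
  also have "\<dots> = (\<integral>\<omega>. (w \<bullet> Y \<omega>)\<^sup>2 \<partial>M) + 2 * (v \<bullet> c) * (w \<bullet> (\<integral>\<omega>. Y \<omega> \<partial>M)) + (v \<bullet> c)\<^sup>2"
    using sq(1) intY by (simp add: prob_space)
  also have "\<dots> = w \<bullet> (cov_matrix M X *v w) + (v \<bullet> c)\<^sup>2"
    by (simp add: meanY cov sq(2))
  finally show "v \<bullet> (MMSE M T \<theta> *v v) =
      (transpose G *v v) \<bullet> (cov_matrix M X *v (transpose G *v v)) + (v \<bullet> c)\<^sup>2"
    unfolding w_def .
qed

section \<open>Comparison of the estimators\<close>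

theorem theorem3p7:
  fixes M :: "'a measure"
    and \<beta>_MLE :: "'a \<Rightarrow> real^'n"
    and \<beta> :: "real^'n"
    and C :: "real^'n^'n"
    and H :: "real^'n^'q"
    and h :: "real^'q"
    and d :: real
  assumes "prob_space M"
    and "positive_definite C"
    and "\<beta>_MLE \<in> borel_measurable M"
    and "integrable M (\<lambda>\<omega>. (norm (\<beta>_MLE \<omega>))\<^sup>2)"
    and "(\<integral>\<omega>. \<beta>_MLE \<omega> \<partial>M) = \<beta>"
    and "cov_matrix M \<beta>_MLE = matrix_inv C"
    and "rank H = CARD('q)"
    and "H *v \<beta> = h"
    and "0 < d" and "d < 1"
  shows "nonneg_definite
           (MMSE M (\<lambda>\<omega>. aule C d (\<beta>_MLE \<omega>)) \<beta> - MMSE M (\<lambda>\<omega>. raule C H h d (\<beta>_MLE \<omega>)) \<beta>)"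
proof -
  interpret prob_space M by fact
  define L where "L = liu_matrix C d"
  define S where "S = matrix_inv C"
  define P where "P = mat 1 - S ** transpose H ** matrix_inv (H ** S ** transpose H) ** H"
  \<comment> \<open>The common bias of both estimators, since \<open>rmle\<close> leaves the mean
    \<beta> unchanged.\<close>
  define c where "c = L *v \<beta> - \<beta>"
  have S: "positive_definite S"
    unfolding S_def by (rule positive_definite_matrix_inv[OF assms(2)])
  have aule: "aule C d (\<beta>_MLE \<omega>) - \<beta> = L *v (\<beta>_MLE \<omega> - (\<integral>\<omega>. \<beta>_MLE \<omega> \<partial>M)) + c" for \<omega>
    by (simp add: aule_def L_def c_def assms(5) matrix_vector_mult_diff_distrib)
  \<comment> \<open>The restriction \<open>H *v \<beta> = h\<close> turns the residual
    \<open>H *v b - h\<close> into \<open>H *v (b - \<beta>)\<close>, so the correction acts on the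
    estimation error alone.\<close>
  have "rmle C H h b = P *v (b - \<beta>) + \<beta>" for b
    by (simp add: rmle_def P_def S_def assms(8)[symmetric] matrix_vector_mult_diff_rdistrib
        matrix_vector_mult_diff_distrib matrix_vector_mul_assoc)
  then have raule:
    "raule C H h d (\<beta>_MLE \<omega>) - \<beta> = (L ** P) *v (\<beta>_MLE \<omega> - (\<integral>\<omega>. \<beta>_MLE \<omega> \<partial>M)) + c" for \<omega>
    by (simp add: raule_def L_def c_def assms(5) matrix_vector_right_distrib
        matrix_vector_mul_assoc[symmetric])
  note A = MMSE_affine[OF assms(3,4) aule] and R = MMSE_affine[OF assms(3,4) raule]
  show ?thesis
    unfolding nonneg_definite_def
  proof (intro conjI allI)
    show "transpose (MMSE M (\<lambda>\<omega>. aule C d (\<beta>_MLE \<omega>)) \<beta> - MMSE M (\<lambda>\<omega>. raule C H h d (\<beta>_MLE \<omega>)) \<beta>)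
      = MMSE M (\<lambda>\<omega>. aule C d (\<beta>_MLE \<omega>)) \<beta> - MMSE M (\<lambda>\<omega>. raule C H h d (\<beta>_MLE \<omega>)) \<beta>"
      using A(1) R(1) by (simp add: transpose_diff)
    fix v :: "real^'n"
    \<comment> \<open>The transpose of \<open>L ** P\<close> applies \<open>transpose L\<close>
      first, so the projection inequality is used at \<open>w = transpose L *v v\<close>; the equal
      bias terms then cancel.\<close>
    have "(transpose P *v (transpose L *v v)) \<bullet> (S *v (transpose P *v (transpose L *v v)))
        \<le> (transpose L *v v) \<bullet> (S *v (transpose L *v v))"
      unfolding P_def by (rule positive_definite_projection_le[OF S assms(7)])
    then have "v \<bullet> (MMSE M (\<lambda>\<omega>. raule C H h d (\<beta>_MLE \<omega>)) \<beta> *v v)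
        \<le> v \<bullet> (MMSE M (\<lambda>\<omega>. aule C d (\<beta>_MLE \<omega>)) \<beta> *v v)"
      by (simp only: A(2) R(2) assms(6) S_def[symmetric] matrix_transpose_mul
          matrix_vector_mul_assoc[symmetric] add_le_cancel_right)
    then show "0 \<le> v \<bullet> ((MMSE M (\<lambda>\<omega>. aule C d (\<beta>_MLE \<omega>)) \<beta>
        - MMSE M (\<lambda>\<omega>. raule C H h d (\<beta>_MLE \<omega>)) \<beta>) *v v)"
      by (simp add: matrix_vector_mult_diff_rdistrib inner_diff_right)
  qed
qed

end
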